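(* Let $n\ge 2$ be an integer with prime factorization $n=p_1^{\alpha_1}\cdots p_k^{\alpha_k}$, where $p_1<p_2<\cdots<p_k$ are primes and $\alpha_i\ge 1$. Let $d_0$ be a divisor of $n$ with $p_1\nmid d_0$, and let $D_n^{d_0}=\{p_1^{\beta_1}d_0 : 0\le\beta_1\le\alpha_1\}$. Then for every subset $D\subseteq D_n^{d_0}$ and every $0\le j\le n-1$, $$\sum_{d\in D} c\left(j,\frac{n}{d}\right)\ \ge\ -\frac{\varphi\left(\frac{n}{d_0}\right)}{p_1-1}.$$
   Context: Here $c$ is the Ramanujan function: for a positive integer $m$ and an integer $j\ge 0$, $$c(j,m)=\mu(t_{m,j})\frac{\varphi(m)}{\varphi(t_{m,j})},\qquad t_{m,j}=\frac{m}{\gcd(m,j)},$$ with $\mu$ the Möbius function, $\varphi$ Euler's totient function, and $\gcd(m,0)=m$. *)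

theory Defs
  imports
    Complex_Main
    "HOL-Computational_Algebra.Squarefree"
    "HOL-Number_Theory.Totient"
begin

text \<open>
  The Moebius function. At the junk argument \<open>0\<close>, which is not squarefree, it has the value \<open>0\<close>.
\<close>
definition moebius :: "nat \<Rightarrow> int" where
  "moebius n = (if squarefree n then (-1) ^ card (prime_factors n) else 0)"

text \<open>
  The value is always an integer, because \<open>m div gcd m j\<close> divides \<open>m\<close> and hence so do the totients;
  it is typed as a real so that the quotient is a genuine division. Only \<open>m > 0\<close> is meaningful.
\<close>
definition ramanujan_c :: "nat \<Rightarrow> nat \<Rightarrow> real" where
  "ramanujan_c j m =
     (let t = m div gcd m j
      in real_of_int (moebius t) * (real (totient m) / real (totient t)))"

end

theory Submission
  imports Defs
begin

text \<open>
  Write \<open>q\<close> for the least prime \<open>p 1\<close> of \<open>n\<close>, \<open>a\<close> for its exponent, and \<open>n = q^a * d0 * M\<close>. As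
  \<open>d\<close> runs through \<open>D\<close>, the quotient \<open>n / d\<close> runs through numbers \<open>q^s * M\<close> with \<open>s\<close> in some
  \<open>B \<subseteq> {0..a}\<close>. The function \<open>c(j, -)\<close> is multiplicative, so the sum factors as \<open>S * c(j, M)\<close> with
  \<open>S = (\<Sum>s\<in>B. c(j, q^s))\<close>, and the claimed bound equals \<open>- q^(a-1) * \<phi>(M)\<close>.

  The factor \<open>S\<close> satisfies \<open>- q^(a-1) \<le> S \<le> q^a\<close>. The upper bound follows from \<open>c(j, m) \<le> \<phi>(m)\<close> and
  \<open>\<phi>(1) + \<phi>(q) + \<dots> + \<phi>(q^a) = q^a\<close>. For the lower bound, \<open>c(j, q^s)\<close> is negative for at most one
  \<open>s\<close>, namely the one for which \<open>q^(s-1)\<close> is the exact power of \<open>q\<close> dividing \<open>j\<close>, and its value there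
  is \<open>- q^(s-1)\<close>.

  If \<open>c(j, M) \<ge> 0\<close>, then \<open>c(j, M) \<le> \<phi>(M)\<close> and the lower bound on \<open>S\<close> suffices. If \<open>c(j, M) < 0\<close>, the
  upper bound on \<open>S\<close> is the relevant one; it is worse by a factor of \<open>q\<close>, and this factor is
  recovered from the minimality of \<open>q\<close>: the number \<open>t = M / gcd(M, j)\<close> is not \<open>1\<close>, so it has a prime
  divisor \<open>r > q\<close>, whence \<open>\<phi>(t) \<ge> r - 1 \<ge> q\<close> and \<open>\<bar>c(j, M)\<bar> \<le> \<phi>(M) / q\<close>.
\<close>

section \<open>Multiplicativity of the Ramanujan function\<close>

lemma moebius_mult_coprime:
  assumes "coprime a b"
  shows "moebius (a * b) = moebius a * moebius b"
proof (cases "a = 0 \<or> b = 0")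
  case True
  then show ?thesis by (auto simp: moebius_def)
next
  case False
  have disj: "prime_factors a \<inter> prime_factors b = {}"
  proof -
    have "\<not> (p dvd a \<and> p dvd b)" if "prime p" for p
      using that assms coprime_common_divisor not_prime_unit by blast
    then show ?thesis by (auto simp: in_prime_factors_iff)
  qed
  have sq: "squarefree (a * b) \<longleftrightarrow> squarefree a \<and> squarefree b"
    using assms squarefree_mult_coprime squarefree_multD by blast
  have "card (prime_factors (a * b)) = card (prime_factors a) + card (prime_factors b)"
    using False disj by (simp add: prime_factors_product card_Un_disjoint)
  then show ?thesis
    by (simp add: moebius_def sq power_add)
qed

lemma moebius_prime_power:
  assumes "prime q"
  shows "moebius (q ^ e) = (if e = 0 then 1 else if e = 1 then -1 else 0)"
  using assms
  by (auto simp: moebius_def squarefree_power_iff squarefree_prime prime_factors_power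
      prime_prime_factors)

lemma abs_moebius_le_1: "\<bar>moebius m\<bar> \<le> 1"
  by (simp add: moebius_def)

lemma gcd_mult_coprime_left:
  fixes a b j :: nat
  assumes "coprime a b"
  shows "gcd (a * b) j = gcd a j * gcd b j"
proof (rule dvd_antisym)
  obtain x y where xy: "gcd (a * b) j = x * y" "x dvd a" "y dvd b"
    using division_decomp[of "gcd (a * b) j" a b] by auto
  moreover have "x * y dvd j"
    using xy(1) by (metis gcd_dvd2)
  ultimately show "gcd (a * b) j dvd gcd a j * gcd b j"
    by (auto intro!: mult_dvd_mono gcd_greatest dest: dvd_mult_left dvd_mult_right)
next
  have "coprime (gcd a j) (gcd b j)"
    by (rule coprime_divisors[OF _ _ assms]) auto
  then have "gcd a j * gcd b j dvd j"
    by (intro divides_mult) auto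
  then show "gcd a j * gcd b j dvd gcd (a * b) j"
    by (intro gcd_greatest mult_dvd_mono) auto
qed

lemma ramanujan_c_mult_coprime:
  assumes "coprime a b"
  shows "ramanujan_c j (a * b) = ramanujan_c j a * ramanujan_c j b"
proof -
  have g: "gcd (a * b) j = gcd a j * gcd b j"
    using assms by (rule gcd_mult_coprime_left)
  define s t where "s = a div gcd a j" and "t = b div gcd b j"
  have st: "a * b div gcd (a * b) j = s * t"
    by (simp add: g s_def t_def div_mult_div_if_dvd)
  have "s dvd a" "t dvd b"
    unfolding s_def t_def by (metis dvd_div_mult_self dvd_triv_left gcd_dvd1)+
  then have "coprime s t"
    using assms coprime_divisors by blast
  then show ?thesis
    using assms
    by (simp add: ramanujan_c_def Let_def st moebius_mult_coprime totient_mult_coprime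
        flip: s_def t_def)
qed


section \<open>Size of the Ramanujan function\<close>

lemma abs_ramanujan_c_le:
  "\<bar>ramanujan_c j m\<bar> \<le> real (totient m) / real (totient (m div gcd m j))"
proof -
  have "\<bar>real_of_int (moebius t)\<bar> \<le> 1" for t
    using abs_moebius_le_1[of t] by linarith
  then show ?thesis
    by (simp add: ramanujan_c_def Let_def abs_mult divide_right_mono mult_left_le_one_le)
qed

lemma abs_ramanujan_c_le_totient: "\<bar>ramanujan_c j m\<bar> \<le> real (totient m)"
proof (cases "m = 0")
  case False
  then have "m div gcd m j > 0"
    by (simp add: dvd_imp_le div_greater_zero_iff)
  then have "real (totient m) / real (totient (m div gcd m j)) \<le> real (totient m) / 1"
    by (intro divide_left_mono) (auto simp: Suc_le_eq)
  then show ?thesis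
    using abs_ramanujan_c_le[of j m] by simp
qed (simp add: ramanujan_c_def)

text \<open>
  A negative value forces \<open>m div gcd m j\<close> to have a prime divisor, and the totient of that divisor
  is at least \<open>q\<close>. The sign matters: if \<open>m\<close> divides \<open>j\<close>, the value is \<open>\<phi>(m)\<close>, with nothing gained.
\<close>
lemma abs_ramanujan_c_le_if_neg:
  assumes "m > 0" and "\<And>r. prime r \<Longrightarrow> r dvd m \<Longrightarrow> q < r"
    and "ramanujan_c j m < 0" and "q > 0"
  shows "\<bar>ramanujan_c j m\<bar> \<le> real (totient m) / real q"
proof -
  define t where "t = m div gcd m j"
  have t: "t > 0" "t dvd m"
    using assms(1) by (auto simp: t_def dvd_imp_le div_greater_zero_iff div_dvd_iff_mult)
  have "t \<noteq> 1"
    using assms(3) by (auto simp: ramanujan_c_def Let_def moebius_def simp flip: t_def)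
  then obtain r where r: "prime r" "r dvd t"
    using prime_factor_nat by blast
  have "q < r"
    using assms(2) r t(2) dvd_trans by blast
  then have "q \<le> totient r"
    using r(1) by (simp add: totient_prime)
  also have "\<dots> \<le> totient t"
    using r t by (intro totient_dvd_mono)
  finally have "real (totient m) / real (totient t) \<le> real (totient m) / real q"
    using assms(4) t by (intro divide_left_mono) auto
  then show ?thesis
    using abs_ramanujan_c_le[of j m] by (simp add: t_def)
qed

section \<open>Sums over powers of one prime\<close>

lemma sum_totient_prime_powers:
  assumes "prime q"
  shows "(\<Sum>s\<le>a. totient (q ^ s)) = q ^ a"
proof (induction a)
  case (Suc a)
  have "q ^ a + q ^ a * (q - 1) = q ^ Suc a"
    using prime_gt_0_nat[OF assms] by (cases q) auto
  then show ?case
    using Suc by (simp add: totient_prime_power_Suc[OF assms] del: power_Suc)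
qed simp

text \<open>
  If \<open>gcd (q ^ s) j = q ^ i\<close>, the Moebius factor is \<open>\<mu>(q ^ (s - i))\<close>, which is negative only for
  \<open>i = s - 1\<close>. The two divisibility conclusions determine \<open>s\<close> from \<open>j\<close>.
\<close>
lemma ramanujan_c_prime_power_neg:
  assumes "prime q" and "ramanujan_c j (q ^ s) < 0"
  shows "s > 0" "q ^ (s - 1) dvd j" "\<not> q ^ s dvd j"
    and "ramanujan_c j (q ^ s) = - (real q ^ (s - 1))"
proof -
  obtain i where i: "i \<le> s" "gcd (q ^ s) j = q ^ i"
    using divides_primepow_nat[OF assms(1), of "gcd (q ^ s) j" s] by auto
  have q: "q > 1"
    using assms(1) by (rule prime_gt_1_nat)
  have t: "q ^ s div gcd (q ^ s) j = q ^ (s - i)"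
    using i q by (simp add: power_diff)
  have si: "s - i = 1"
    using assms(2)
    by (auto simp: ramanujan_c_def Let_def t moebius_prime_power[OF assms(1)] split: if_splits)
  then show "s > 0" by simp
  have i_eq: "i = s - 1" using si by simp
  show "q ^ (s - 1) dvd j"
    using i(2) i_eq by (metis gcd_dvd2)
  show "\<not> q ^ s dvd j"
  proof
    assume "q ^ s dvd j"
    then have "q ^ i = q ^ s" using i(2) by (simp add: gcd_nat.absorb1)
    then show False using q si by simp
  qed
  have "totient (q ^ s) = q ^ (s - 1) * (q - 1)"
    using totient_prime_power[OF assms(1) \<open>s > 0\<close>] .
  then show "ramanujan_c j (q ^ s) = - (real q ^ (s - 1))"
    using q moebius_prime_power[OF assms(1), of 1]
    by (simp add: ramanujan_c_def Let_def t si totient_prime[OF assms(1)])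
qed

text \<open>
  There is at most one negative term: two exponents \<open>s1 < s2\<close> with negative terms would give
  \<open>q ^ s1 dvd q ^ (s2 - 1) dvd j\<close>, against the maximality of the power \<open>s1 - 1\<close>.
\<close>
lemma sum_ramanujan_c_prime_powers_ge:
  assumes "prime q" and "B \<subseteq> {..a}"
  shows "(\<Sum>s\<in>B. ramanujan_c j (q ^ s)) \<ge> - (real q ^ (a - 1))"
proof (cases "\<exists>s\<in>B. ramanujan_c j (q ^ s) < 0")
  case False
  then have "(\<Sum>s\<in>B. ramanujan_c j (q ^ s)) \<ge> 0"
    by (intro sum_nonneg) force
  moreover have "real q ^ (a - 1) \<ge> 0" by simp
  ultimately show ?thesis by linarith
next
  case True
  have fin: "finite B" using assms(2) finite_subset by blast
  obtain s where s: "s \<in> B" "ramanujan_c j (q ^ s) < 0" using True by blast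
  note neg = ramanujan_c_prime_power_neg[OF assms(1)]
  have uniq: "\<not> s1 < s2" if "ramanujan_c j (q ^ s1) < 0" "ramanujan_c j (q ^ s2) < 0" for s1 s2
  proof
    assume "s1 < s2"
    then have "q ^ s1 dvd q ^ (s2 - 1)" by (intro le_imp_power_dvd) simp
    then show False using neg(2)[OF that(2)] neg(3)[OF that(1)] dvd_trans by blast
  qed
  have "ramanujan_c j (q ^ r) \<ge> 0" if "r \<in> B - {s}" for r
    using uniq[of r s] uniq[of s r] s(2) that by (cases r s rule: linorder_cases) force+
  then have "(\<Sum>r\<in>B - {s}. ramanujan_c j (q ^ r)) \<ge> 0"
    by (rule sum_nonneg)
  moreover have "(\<Sum>r\<in>B. ramanujan_c j (q ^ r))
      = ramanujan_c j (q ^ s) + (\<Sum>r\<in>B - {s}. ramanujan_c j (q ^ r))"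
    using fin s(1) by (rule sum.remove)
  moreover have "real q ^ (s - 1) \<le> real q ^ (a - 1)"
    using assms s(1) prime_ge_1_nat[OF assms(1)] by (intro power_increasing) auto
  ultimately show ?thesis using neg(4)[OF s(2)] by linarith
qed

lemma sum_ramanujan_c_prime_powers_le:
  assumes "prime q" and "B \<subseteq> {..a}"
  shows "(\<Sum>s\<in>B. ramanujan_c j (q ^ s)) \<le> real q ^ a"
proof -
  have "(\<Sum>s\<in>B. ramanujan_c j (q ^ s)) \<le> (\<Sum>s\<in>B. real (totient (q ^ s)))"
    by (intro sum_mono) (use abs_ramanujan_c_le_totient abs_le_D1 in blast)
  also have "\<dots> \<le> (\<Sum>s\<le>a. real (totient (q ^ s)))"
    using assms(2) by (intro sum_mono2) auto
  also have "\<dots> = real q ^ a"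
    using sum_totient_prime_powers[OF assms(1), of a] by (simp flip: of_nat_sum of_nat_power)
  finally show ?thesis .
qed

section \<open>The lower bound\<close>

text \<open>
  The sum is \<open>S * c\<close> with \<open>c = ramanujan_c j M\<close>. The sign of \<open>c\<close> decides which of the two bounds on \<open>S\<close>
  matters; for negative \<open>c\<close>, the larger bound \<open>q ^ a\<close> is offset by the gain of \<open>1 / q\<close> in the size of
  \<open>c\<close> that comes from all primes of \<open>M\<close> exceeding \<open>q\<close>.
\<close>
lemma sum_ramanujan_c_ge:
  assumes q: "prime q" and "M > 0" and big: "\<And>r. prime r \<Longrightarrow> r dvd M \<Longrightarrow> q < r"
    and "a > 0" and B: "B \<subseteq> {..a}"
  shows "(\<Sum>s\<in>B. ramanujan_c j (q ^ s * M)) \<ge> - (real q ^ (a - 1) * real (totient M))"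
proof -
  define S where "S = (\<Sum>s\<in>B. ramanujan_c j (q ^ s))"
  define c where "c = ramanujan_c j M"
  have "\<not> q dvd M"
    using big q by blast
  then have cop: "coprime (q ^ s) M" for s
    using q by (simp add: prime_imp_coprime)
  have eq: "(\<Sum>s\<in>B. ramanujan_c j (q ^ s * M)) = S * c"
    by (simp add: S_def c_def sum_distrib_right ramanujan_c_mult_coprime[OF cop])
  have q0: "q > 0" using q by (rule prime_gt_0_nat)
  have "- (real q ^ (a - 1) * real (totient M)) \<le> S * c"
  proof (cases "c < 0")
    case False
    have "c \<le> real (totient M)"
      using abs_ramanujan_c_le_totient[of j M] by (simp add: c_def)
    then have "real q ^ (a - 1) * c \<le> real q ^ (a - 1) * real (totient M)"
      by (intro mult_left_mono) auto
    moreover have "- (real q ^ (a - 1)) * c \<le> S * c"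
      using False sum_ramanujan_c_prime_powers_ge[OF q B]
      by (intro mult_right_mono) (auto simp: S_def)
    ultimately show ?thesis by simp
  next
    case True
    have "- c \<le> real (totient M) / real q"
      using abs_ramanujan_c_le_if_neg[of M q j] assms(2) big True q0 by (simp add: c_def)
    then have "real q ^ a * - c \<le> real q ^ a * (real (totient M) / real q)"
      by (intro mult_left_mono) auto
    also have "\<dots> = real q ^ (a - 1) * real (totient M)"
      using q0 assms(4) by (simp add: power_eq_if)
    finally have "real q ^ a * - c \<le> real q ^ (a - 1) * real (totient M)" .
    moreover have "real q ^ a * c \<le> S * c"
      using True sum_ramanujan_c_prime_powers_le[OF q B]
      by (intro mult_right_mono_neg) (auto simp: S_def)
    ultimately show ?thesis by simp
  qed
  then show ?thesis by (simp add: eq)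
qed

theorem lemma1:
  fixes n k d0 j :: nat
    and p \<alpha> :: "nat \<Rightarrow> nat"
    and D :: "nat set"
  assumes "n \<ge> 2"
    and "n = (\<Prod>i=1..k. p i ^ \<alpha> i)"
    and "\<And>i. i \<in> {1..k} \<Longrightarrow> prime (p i)"
    and "strict_mono_on {1..k} p"
    and "\<And>i. i \<in> {1..k} \<Longrightarrow> \<alpha> i \<ge> 1"
    and "d0 dvd n"
    and "\<not> p 1 dvd d0"
    and "D \<subseteq> {p 1 ^ \<beta> * d0 | \<beta>. \<beta> \<le> \<alpha> 1}"
    and "j \<le> n - 1"
  shows "(\<Sum>d\<in>D. ramanujan_c j (n div d)) \<ge> - (real (totient (n div d0)) / (real (p 1) - 1))"
proof -
  define q a where "q = p 1" and "a = \<alpha> 1"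
  have "k \<noteq> 0"
    using assms(1,2) by (intro notI) simp
  then have k: "1 \<in> {1..k}" by simp
  have q: "prime q" and a: "a > 0"
    using assms(3)[OF k] assms(5)[OF k] by (simp_all add: q_def a_def)
  have q1: "q > 1" using q by (rule prime_gt_1_nat)
  define M0 where "M0 = (\<Prod>i\<in>{1..k} - {1}. p i ^ \<alpha> i)"
  have n: "n = q ^ a * M0"
    unfolding assms(2) M0_def q_def a_def using k by (intro prod.remove) auto
  have "coprime (q ^ a) d0"
    using q assms(7) by (simp add: prime_imp_coprime q_def)
  then have "d0 dvd M0"
    using assms(6) n by (metis coprime_commute coprime_dvd_mult_right_iff)
  then obtain M where M: "M0 = d0 * M" by (elim dvdE)
  have nz: "d0 > 0" "M > 0"
    using assms(1) n M by (auto intro!: Nat.gr0I)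
  have big: "q < r" if r: "prime r" "r dvd M" for r
  proof -
    have "r dvd (\<Prod>i\<in>{1..k} - {1}. p i ^ \<alpha> i)"
      unfolding M0_def[symmetric] using r M by simp
    then have "\<exists>i\<in>{1..k} - {1}. r dvd p i ^ \<alpha> i"
      by (subst (asm) prime_dvd_prod_iff) (use r(1) in simp_all)
    then obtain i where i: "i \<in> {1..k} - {1}" "r dvd p i ^ \<alpha> i" ..
    then have "r = p i"
      using assms(3)[of i] r(1) prime_dvd_power primes_dvd_imp_eq by blast
    moreover have "p 1 < p i"
      using i(1) k by (intro strict_mono_onD[OF assms(4)]) auto
    ultimately show ?thesis by (simp add: q_def)
  qed
  \<comment> \<open>The divisor \<open>q ^ \<beta> * d0\<close> is indexed by \<open>s = a - \<beta>\<close>, the exponent of \<open>q\<close> in the quotient.\<close>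
  define B where "B = {s. s \<le> a \<and> q ^ (a - s) * d0 \<in> D}"
  define f where "f s = q ^ (a - s) * d0" for s
  have bij: "bij_betw f B D"
  proof (rule bij_betwI')
    show "f x = f y \<longleftrightarrow> x = y" if "x \<in> B" "y \<in> B" for x y
      using that q1 nz by (auto simp: f_def B_def)
    show "f x \<in> D" if "x \<in> B" for x
      using that by (simp add: f_def B_def)
    show "\<exists>x\<in>B. d = f x" if "d \<in> D" for d
    proof -
      obtain b where "b \<le> a" "d = q ^ b * d0"
        using assms(8) \<open>d \<in> D\<close> by (auto simp: q_def a_def)
      then show ?thesis
        using that by (intro bexI[of _ "a - b"]) (auto simp: f_def B_def)
    qed
  qed
  have div: "n div f s = q ^ s * M" if "s \<in> B" for s
  proof -
    have "q ^ a = q ^ (a - s) * q ^ s"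
      using that by (simp add: B_def flip: power_add)
    then have "n = f s * (q ^ s * M)"
      by (simp add: n M f_def)
    then show ?thesis
      using nz q1 by (simp add: f_def)
  qed
  have "(\<Sum>d\<in>D. ramanujan_c j (n div d)) = (\<Sum>s\<in>B. ramanujan_c j (n div f s))"
    using bij by (rule sum.reindex_bij_betw[symmetric])
  also have "\<dots> = (\<Sum>s\<in>B. ramanujan_c j (q ^ s * M))"
    by (intro sum.cong) (simp_all add: div)
  also have "\<dots> \<ge> - (real q ^ (a - 1) * real (totient M))"
    by (rule sum_ramanujan_c_ge[OF q nz(2) big a]) (auto simp: B_def)
  finally have ge: "(\<Sum>d\<in>D. ramanujan_c j (n div d)) \<ge> - (real q ^ (a - 1) * real (totient M))" .
  have "n div d0 = q ^ a * M"
    using n M nz by simp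
  moreover have "coprime (q ^ a) M"
    using q big by (auto intro!: prime_imp_coprime)
  ultimately have "totient (n div d0) = q ^ (a - 1) * (q - 1) * totient M"
    by (simp add: totient_mult_coprime totient_prime_power[OF q a])
  then have "real (totient (n div d0)) / (real q - 1) = real q ^ (a - 1) * real (totient M)"
    using q1 by simp
  then show ?thesis
    using ge by (simp add: q_def)
qed

end
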